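(* For every $n\geqslant 4$, regard the Cayley–Dickson algebra $\mathbb{A}_n$ as a Hilbert left $\mathbb{O}$-module, with left $\mathbb{O}$-multiplication given by the product of $\mathbb{A}_n$ and $\mathbb{O}$-inner product $\langle s,w\rangle_n:=\pi_{\mathbb{O}}(s\overline{w})$. Then there is an isomorphism of Hilbert left $\mathbb{O}$-modules $$\mathbb{A}_n\cong\mathbb{O}^{2^{n-4}}\oplus\overline{\mathbb{O}}^{\,2^{n-4}}.$$
   Context: $\mathbb{O}$ is the real algebra of octonions with its standard real basis $e_0=1,e_1,\dots,e_7$ and $\operatorname{Re}x=\tfrac12(x+\overline{x})$; $\mathbb{A}_3=\mathbb{O}$. For $n\ge 4$ the Cayley–Dickson algebra $\mathbb{A}_n$ is defined inductively: its elements are written uniquely as $a+be_{2^{n-1}}$ with $a,b\in\mathbb{A}_{n-1}$, conjugation is $\overline{a+be_{2^{n-1}}}=\overline{a}-be_{2^{n-1}}$, and multiplication is $$(a+be_{2^{n-1}})(c+de_{2^{n-1}})=(ac-\overline{d}b)+(da+b\overline{c})e_{2^{n-1}}.$$ $\mathbb{A}_n$ has canonical real basis $e_0,\dots,e_{2^n-1}$ where $e_{2^{n-1}+j}:=e_je_{2^{n-1}}$ for $1\le j\le 2^{n-1}-1$, and $\mathbb{O}\subset\mathbb{A}_n$ is the span of $e_0,\dots,e_7$. $\pi_{\mathbb{O}}:\mathbb{A}_n\to\mathbb{O}$ is the projection onto $\mathbb{O}$ killing $e_8,\dots,e_{2^n-1}$. A left $\mathbb{O}$-module is a real vector space $M$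 with an $\mathbb{R}$-linear map $L:\mathbb{O}\to\operatorname{End}_{\mathbb{R}}(M)$, written $px:=L_p(x)$, such that $1x=x$ and $p(px)=p^2x$ for all $p\in\mathbb{O}$, $x\in M$. A Hilbert left $\mathbb{O}$-module is a left $\mathbb{O}$-module $H$ with an $\mathbb{R}$-bilinear map $\langle\cdot,\cdot\rangle:H\times H\to\mathbb{O}$ such that for all $u,v\in H$, $p\in\mathbb{O}$: (1) $\operatorname{Re}(\langle pu,v\rangle-p\langle u,v\rangle)=0$; (2) $\langle u,v\rangle=\overline{\langle v,u\rangle}$; (3) $\langle u,u\rangle\in[0,\infty)$, and $\langle u,u\rangle=0$ iff $u=0$; and $H$ is complete for the norm $\|u\|=\sqrt{\langle u,u\rangle}$. ($\mathbb{A}_n$ with the data above is such a module.) $\mathbb{O}$ is a Hilbert left $\mathbb{O}$-module under left multiplication with $\langle x,y\rangle_{\mathbb{O}}=x\overline{y}$. $\overline{\mathbb{O}}$ denotes the set $\mathbb{O}$ with left module structure $p\hat{\cdot}x:=\overline{p}x$ and $\mathbb{O}$-inner product $\langle x,y\rangle_{\overline{\mathbb{O}}}=y\overline{x}$. Direct sums (and powers) carry the componentwise module structure and the sum of the $\mathbb{O}$-inner products of the components. An isomorphism of Hilbert left $\mathbb{O}$-modules is a bijective map $f:H_1\to H_2$ with $f(px)=pf(x)$ and $\langle f(x),f(y)\rangle_2=\langle x,y\rangle_1$ for all $p\in\mathbb{O}$, $x,y\in H_1$. *)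

theory Defs
  imports "HOL-Analysis.Analysis" "HOL-Library.Function_Algebras"
begin

instantiation "fun" :: (type, real_vector) real_vector
begin

definition "scaleR r f = (\<lambda>x. r *\<^sub>R f x)"

instance
  by standard (auto simp: scaleR_fun_def fun_eq_iff scaleR_add_right scaleR_add_left)

end


section \<open>Cayley--Dickson algebras\<close>

text \<open>
  An element of the algebra of level \<open>n\<close> is its family of coordinates with respect to the canonical
  basis \<open>e\<^sub>0, \<dots>\<close> (of length \<open>2 ^ n\<close>), extended by zero. Hence the inclusions between the algebras,
  in particular that of the octonions (level 3), are inclusions of sets.
  The pointwise product of functions provided by \<open>Function_Algebras\<close> plays no role.
\<close>

type_synonym cd = "nat \<Rightarrow> real"

definition cd_carrier :: "nat \<Rightarrow> cd set" where
  "cd_carrier n = {x. \<forall>i\<ge>2 ^ n. x i = 0}"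

definition cd_basis :: "nat \<Rightarrow> cd" where
  "cd_basis j = (\<lambda>i. if i = j then 1 else 0)"

text \<open>
  \<open>cd_join n a b\<close> is the element \<open>a + b e\<close> of level \<open>Suc n\<close>, where \<open>e\<close> is the basis vector of
  index \<open>2 ^ n\<close>; \<open>cd_lo n\<close> and \<open>cd_hi n\<close> recover \<open>a\<close> and \<open>b\<close>.
\<close>

definition cd_join :: "nat \<Rightarrow> cd \<Rightarrow> cd \<Rightarrow> cd" where
  "cd_join n a b =
     (\<lambda>i. if i < 2 ^ n then a i else if i < 2 ^ Suc n then b (i - 2 ^ n) else 0)"

definition cd_lo :: "nat \<Rightarrow> cd \<Rightarrow> cd" where
  "cd_lo n x = (\<lambda>i. if i < 2 ^ n then x i else 0)"

definition cd_hi :: "nat \<Rightarrow> cd \<Rightarrow> cd" where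
  "cd_hi n x = (\<lambda>i. if i < 2 ^ n then x (2 ^ n + i) else 0)"

primrec cd_conj :: "nat \<Rightarrow> cd \<Rightarrow> cd" where
  "cd_conj 0 x = x"
| "cd_conj (Suc n) x = cd_join n (cd_conj n (cd_lo n x)) (- cd_hi n x)"

text \<open>
  The doubling starts with the real numbers at level 0; level 3 is the algebra of octonions with the
  multiplication table checked in \<open>oct_table\<close> below.
\<close>

primrec cd_mult :: "nat \<Rightarrow> cd \<Rightarrow> cd \<Rightarrow> cd" where
  "cd_mult 0 x y = (\<lambda>i. if i = 0 then x 0 * y 0 else 0)"
| "cd_mult (Suc n) x y =
     (let a = cd_lo n x; b = cd_hi n x; c = cd_lo n y; d = cd_hi n y
      in cd_join n (cd_mult n a c - cd_mult n (cd_conj n d) b)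
                   (cd_mult n d a + cd_mult n b (cd_conj n c)))"

lemma cd_lo_in_carrier [simp]: "cd_lo n x \<in> cd_carrier n"
  and cd_hi_in_carrier [simp]: "cd_hi n x \<in> cd_carrier n"
  by (auto simp: cd_lo_def cd_hi_def cd_carrier_def)

lemma cd_join_in_carrier: "cd_join n a b \<in> cd_carrier (Suc n)"
  by (auto simp: cd_join_def cd_carrier_def)

lemma cd_join_lo_hi: "x \<in> cd_carrier (Suc n) \<Longrightarrow> cd_join n (cd_lo n x) (cd_hi n x) = x"
  by (auto simp: cd_join_def cd_lo_def cd_hi_def cd_carrier_def fun_eq_iff not_less)

lemma cd_lo_join: "a \<in> cd_carrier n \<Longrightarrow> cd_lo n (cd_join n a b) = a"
  and cd_hi_join: "b \<in> cd_carrier n \<Longrightarrow> cd_hi n (cd_join n a b) = b"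
  by (auto simp: cd_join_def cd_lo_def cd_hi_def cd_carrier_def fun_eq_iff not_less)

abbreviation octonions :: "cd set" where "octonions \<equiv> cd_carrier 3"
abbreviation oct_mult :: "cd \<Rightarrow> cd \<Rightarrow> cd" where "oct_mult \<equiv> cd_mult 3"
abbreviation oct_conj :: "cd \<Rightarrow> cd" where "oct_conj \<equiv> cd_conj 3"

definition oct_Re :: "cd \<Rightarrow> cd" where
  "oct_Re x = (1 / 2) *\<^sub>R (x + oct_conj x)"

definition oct_proj :: "cd \<Rightarrow> cd" where
  "oct_proj x = (\<lambda>i. if i < 8 then x i else 0)"


section \<open>Hilbert left octonion modules\<close>

text \<open>
  The underlying real vector space is a subspace of an ambient real vector space; action and inner
  product are only relevant on octonions and on the carrier.
\<close>

record 'v omod =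
  ocarrier :: "'v set"
  oact :: "cd \<Rightarrow> 'v \<Rightarrow> 'v"
  oinner :: "'v \<Rightarrow> 'v \<Rightarrow> cd"

definition onorm :: "('v, 'm) omod_scheme \<Rightarrow> 'v \<Rightarrow> real" where
  "onorm M u = sqrt (oinner M u u 0)"

locale left_O_module =
  fixes M :: "('v :: real_vector, 'm) omod_scheme"
  assumes subspace_carrier: "subspace (ocarrier M)"
    and act_closed: "p \<in> octonions \<Longrightarrow> x \<in> ocarrier M \<Longrightarrow> oact M p x \<in> ocarrier M"
    and act_add: "p \<in> octonions \<Longrightarrow> x \<in> ocarrier M \<Longrightarrow> y \<in> ocarrier M \<Longrightarrow>
           oact M p (x + y) = oact M p x + oact M p y"
    and act_scaleR: "p \<in> octonions \<Longrightarrow> x \<in> ocarrier M \<Longrightarrow>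
           oact M p (r *\<^sub>R x) = r *\<^sub>R oact M p x"
    and add_act: "p \<in> octonions \<Longrightarrow> q \<in> octonions \<Longrightarrow> x \<in> ocarrier M \<Longrightarrow>
           oact M (p + q) x = oact M p x + oact M q x"
    and scaleR_act: "p \<in> octonions \<Longrightarrow> x \<in> ocarrier M \<Longrightarrow>
           oact M (r *\<^sub>R p) x = r *\<^sub>R oact M p x"
    and one_act: "x \<in> ocarrier M \<Longrightarrow> oact M (cd_basis 0) x = x"
    and act_act: "p \<in> octonions \<Longrightarrow> x \<in> ocarrier M \<Longrightarrow>
           oact M p (oact M p x) = oact M (oct_mult p p) x"

locale hilbert_left_O_module = left_O_module M
  for M :: "('v :: real_vector, 'm) omod_scheme" +
  assumes inner_closed: "u \<in> ocarrier M \<Longrightarrow> v \<in> ocarrier M \<Longrightarrow> oinner M u v \<in> octonions"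
    and inner_add_left: "u \<in> ocarrier M \<Longrightarrow> v \<in> ocarrier M \<Longrightarrow> w \<in> ocarrier M \<Longrightarrow>
           oinner M (u + v) w = oinner M u w + oinner M v w"
    and inner_add_right: "u \<in> ocarrier M \<Longrightarrow> v \<in> ocarrier M \<Longrightarrow> w \<in> ocarrier M \<Longrightarrow>
           oinner M u (v + w) = oinner M u v + oinner M u w"
    and inner_scaleR_left: "u \<in> ocarrier M \<Longrightarrow> v \<in> ocarrier M \<Longrightarrow>
           oinner M (r *\<^sub>R u) v = r *\<^sub>R oinner M u v"
    and inner_scaleR_right: "u \<in> ocarrier M \<Longrightarrow> v \<in> ocarrier M \<Longrightarrow>
           oinner M u (r *\<^sub>R v) = r *\<^sub>R oinner M u v"
    and Re_inner_act: "u \<in> ocarrier M \<Longrightarrow> v \<in> ocarrier M \<Longrightarrow> p \<in> octonions \<Longrightarrow>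
           oct_Re (oinner M (oact M p u) v - oct_mult p (oinner M u v)) = 0"
    and inner_conj: "u \<in> ocarrier M \<Longrightarrow> v \<in> ocarrier M \<Longrightarrow>
           oinner M u v = oct_conj (oinner M v u)"
    and inner_nonneg: "u \<in> ocarrier M \<Longrightarrow> \<exists>r\<ge>0. oinner M u u = r *\<^sub>R cd_basis 0"
    and inner_eq_0_iff: "u \<in> ocarrier M \<Longrightarrow> oinner M u u = 0 \<longleftrightarrow> u = 0"
    and complete: "Metric_space.mcomplete (ocarrier M) (\<lambda>u v. onorm M (u - v))"

definition is_hilbert_O_iso ::
  "('v \<Rightarrow> 'w) \<Rightarrow> ('v, 'm) omod_scheme \<Rightarrow> ('w, 'n) omod_scheme \<Rightarrow> bool" where
  "is_hilbert_O_iso f M N \<longleftrightarrow>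
     bij_betw f (ocarrier M) (ocarrier N) \<and>
     (\<forall>p\<in>octonions. \<forall>x\<in>ocarrier M. f (oact M p x) = oact N p (f x)) \<and>
     (\<forall>x\<in>ocarrier M. \<forall>y\<in>ocarrier M. oinner N (f x) (f y) = oinner M x y)"

definition oct_module :: "cd omod" where
  "oct_module = \<lparr> ocarrier = octonions,
     oact = oct_mult,
     oinner = (\<lambda>x y. oct_mult x (oct_conj y)) \<rparr>"

definition oct_conj_module :: "cd omod" where
  "oct_conj_module = \<lparr> ocarrier = octonions,
     oact = (\<lambda>p x. oct_mult (oct_conj p) x),
     oinner = (\<lambda>x y. oct_mult y (oct_conj x)) \<rparr>"

definition cd_module :: "nat \<Rightarrow> cd omod" where
  "cd_module n = \<lparr> ocarrier = cd_carrier n,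
     oact = cd_mult n,
     oinner = (\<lambda>s w. oct_proj (cd_mult n s (cd_conj n w))) \<rparr>"

definition omod_sum :: "'v omod \<Rightarrow> 'w omod \<Rightarrow> ('v \<times> 'w) omod" (infixr "\<oplus>\<^sub>O" 65) where
  "M \<oplus>\<^sub>O N = \<lparr> ocarrier = ocarrier M \<times> ocarrier N,
     oact = (\<lambda>p (x, y). (oact M p x, oact N p y)),
     oinner = (\<lambda>(x, y) (x', y'). oinner M x x' + oinner N y y') \<rparr>"

text \<open>A \<open>k\<close>-tuple is encoded as a function on the naturals which is zero from \<open>k\<close> on.\<close>

definition omod_power :: "('v :: zero) omod \<Rightarrow> nat \<Rightarrow> (nat \<Rightarrow> 'v) omod" (infixr "^\<^sub>O" 80) where
  "M ^\<^sub>O k = \<lparr> ocarrier = {f. (\<forall>i<k. f i \<in> ocarrier M) \<and> (\<forall>i\<ge>k. f i = 0)},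
     oact = (\<lambda>p f i. if i < k then oact M p (f i) else 0),
     oinner = (\<lambda>f g. \<Sum>i<k. oinner M (f i) (g i)) \<rparr>"


section \<open>Agreement with the canonical basis\<close>

lemma cd_parts_zero: "cd_lo n 0 = 0" "cd_hi n 0 = 0" "cd_join n 0 0 = 0"
  by (auto simp: cd_lo_def cd_hi_def cd_join_def fun_eq_iff)

lemma cd_parts_minus:
  "cd_lo n (- x) = - cd_lo n x" "cd_hi n (- x) = - cd_hi n x"
  "cd_join n (- a) (- b) = - cd_join n a b"
  by (auto simp: cd_lo_def cd_hi_def cd_join_def fun_eq_iff)

lemma cd_conj_zero: "cd_conj n 0 = 0"
  by (induction n) (simp_all add: cd_parts_zero del: zero_fun_apply uminus_apply)

lemma cd_conj_minus: "cd_conj n (- x) = - cd_conj n x"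
  by (induction n arbitrary: x)
    (simp_all add: cd_parts_minus(1,2) del: zero_fun_apply uminus_apply flip: cd_parts_minus(3))

lemma cd_mult_zero: "cd_mult n 0 x = 0" "cd_mult n x 0 = 0"
proof (induction n arbitrary: x)
  case 0
  { case 1 show ?case by (auto simp: fun_eq_iff) }
  { case 2 show ?case by (auto simp: fun_eq_iff) }
next
  case (Suc n)
  { case 1 show ?case by (simp add: cd_parts_zero cd_conj_zero Suc.IH Let_def
          del: zero_fun_apply uminus_apply) }
  { case 2 show ?case by (simp add: cd_parts_zero cd_conj_zero Suc.IH Let_def
          del: zero_fun_apply uminus_apply) }
qed

lemma cd_mult_minus: "cd_mult n (- x) y = - cd_mult n x y" "cd_mult n x (- y) = - cd_mult n x y"
proof (induction n arbitrary: x y)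
  case 0
  { case 1 show ?case by (auto simp: fun_eq_iff) }
  { case 2 show ?case by (auto simp: fun_eq_iff) }
next
  case (Suc n)
  { case 1 show ?case
      by (simp add: cd_parts_minus(1,2) Suc.IH Let_def del: zero_fun_apply uminus_apply
          flip: cd_parts_minus(3)) }
  { case 2 show ?case
      by (simp add: cd_parts_minus(1,2) cd_conj_minus Suc.IH Let_def minus_diff_commute
          del: zero_fun_apply uminus_apply
          flip: cd_parts_minus(3)) }
qed

lemma cd_lo_basis: "cd_lo n (cd_basis j) = (if j < 2 ^ n then cd_basis j else 0)"
  and cd_hi_basis: "j < 2 ^ Suc n \<Longrightarrow>
    cd_hi n (cd_basis j) = (if j < 2 ^ n then 0 else cd_basis (j - 2 ^ n))"
  by (auto simp: cd_lo_def cd_hi_def cd_basis_def fun_eq_iff)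

lemma cd_join_basis:
  assumes "j < 2 ^ n"
  shows "cd_join n (cd_basis j) 0 = cd_basis j"
    and "cd_join n 0 (cd_basis j) = cd_basis (2 ^ n + j)"
    and "cd_join n (- cd_basis j) 0 = - cd_basis j"
    and "cd_join n 0 (- cd_basis j) = - cd_basis (2 ^ n + j)"
  using assms by (auto simp: cd_join_def cd_basis_def fun_eq_iff)

lemma cd_conj_basis:
  "j < 2 ^ n \<Longrightarrow> cd_conj n (cd_basis j) = (if j = 0 then cd_basis 0 else - cd_basis j)"
  by (induction n arbitrary: j) (auto simp: cd_lo_basis cd_hi_basis cd_join_basis cd_conj_zero)

lemma cd_mult_one_left: "x \<in> cd_carrier n \<Longrightarrow> cd_mult n (cd_basis 0) x = x"
  and cd_mult_one_right: "x \<in> cd_carrier n \<Longrightarrow> cd_mult n x (cd_basis 0) = x"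
proof -
  have "\<forall>x\<in>cd_carrier n. cd_mult n (cd_basis 0) x = x \<and> cd_mult n x (cd_basis 0) = x"
  proof (induction n)
    case 0
    show ?case by (auto simp: cd_carrier_def cd_basis_def fun_eq_iff)
  next
    case (Suc n)
    then show ?case
      by (simp add: Let_def cd_lo_basis cd_hi_basis cd_mult_zero cd_conj_basis cd_conj_zero cd_join_lo_hi)
  qed
  then show "x \<in> cd_carrier n \<Longrightarrow> cd_mult n (cd_basis 0) x = x"
    and "x \<in> cd_carrier n \<Longrightarrow> cd_mult n x (cd_basis 0) = x"
    by auto
qed

lemma cd_basis_double:
  assumes "j < 2 ^ n"
  shows "cd_basis (2 ^ n + j) = cd_mult (Suc n) (cd_basis j) (cd_basis (2 ^ n))"
proof -
  have "cd_basis j \<in> cd_carrier n"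
    using assms by (auto simp: cd_carrier_def cd_basis_def)
  with assms show ?thesis
    by (simp add: Let_def cd_lo_basis cd_hi_basis cd_mult_zero cd_conj_zero cd_join_basis
        cd_mult_one_left cd_mult_one_right)
qed

lemma oct_table:
  "(i, j, k) \<in> {(1,2,3), (1,4,5), (1,7,6), (2,4,6), (2,5,7), (3,4,7), (3,6,5)} \<Longrightarrow>
     oct_mult (cd_basis i) (cd_basis j) = cd_basis k \<and>
     oct_mult (cd_basis j) (cd_basis k) = cd_basis i \<and>
     oct_mult (cd_basis k) (cd_basis i) = cd_basis j"
proof -
  have base: "cd_mult 0 (cd_basis 0) (cd_basis 0) = cd_basis 0" "cd_conj 0 (cd_basis 0) = cd_basis 0"
    by (auto simp: cd_basis_def fun_eq_iff)
  assume "(i, j, k) \<in> {(1,2,3), (1,4,5), (1,7,6), (2,4,6), (2,5,7), (3,4,7), (3,6,5)}"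
  then show ?thesis
    by (elim insertE emptyE)
      (simp_all add: numeral_3_eq_3 Let_def cd_lo_basis cd_hi_basis cd_parts_zero
        cd_parts_minus(1,2) cd_mult_zero cd_conj_zero cd_conj_minus cd_conj_basis cd_mult_minus
        cd_join_basis base del: cd_mult.simps(1) cd_conj.simps(1))
qed

end

theory Submission
  imports Defs
begin

text \<open>
  For an octonion \<open>p\<close> and \<open>n \<ge> 3\<close> the doubling formula gives \<open>p (a + b e) = p a + (b p) e\<close>, and
  the octonion part of \<open>(a + b e) (c + d e)\<^sup>*\<close> is that of \<open>a c\<^sup>* + d\<^sup>* b\<close>, where the star denotes
  conjugation. Since \<open>(b p)\<^sup>* = p\<^sup>* b\<^sup>*\<close>, the map \<open>a + b e \<mapsto> (a, b\<^sup>*)\<close> identifies the algebra of level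
  \<open>n + 1\<close> with the sum of the module of level \<open>n\<close> and its twist, in which \<open>p\<close> acts as \<open>p\<^sup>*\<close> and the
  arguments of the inner product are exchanged. Twisting exchanges the two kinds of octonion summands,
  so by induction both kinds occur equally often.

  The Cayley--Dickson side is a Hilbert module because, at every level, real parts of products are
  invariant under commutation and reassociation, and the norm is the Euclidean one.
  The direct sum inherits the axioms, including completeness, along the linear isomorphism.
\<close>

section \<open>Cayley--Dickson algebras\<close>

lemma cd_parts_add:
  "cd_lo n (x + y) = cd_lo n x + cd_lo n y" "cd_hi n (x + y) = cd_hi n x + cd_hi n y"
  "cd_join n (a + b) (c + d) = cd_join n a c + cd_join n b d"
  by (auto simp: cd_lo_def cd_hi_def cd_join_def fun_eq_iff)

lemma cd_parts_scaleR:
  "cd_lo n (r *\<^sub>R x) = r *\<^sub>R cd_lo n x" "cd_hi n (r *\<^sub>R x) = r *\<^sub>R cd_hi n x"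
  "cd_join n (r *\<^sub>R a) (r *\<^sub>R b) = r *\<^sub>R cd_join n a b"
  by (auto simp: cd_lo_def cd_hi_def cd_join_def fun_eq_iff scaleR_fun_def)

lemma subspace_cd_carrier: "subspace (cd_carrier n)"
  by (auto simp: subspace_def cd_carrier_def scaleR_fun_def)

lemmas cd_carrier_add = subspace_add[OF subspace_cd_carrier]
  and cd_carrier_diff = subspace_diff[OF subspace_cd_carrier]
  and cd_carrier_minus = subspace_neg[OF subspace_cd_carrier]
  and cd_carrier_scaleR = subspace_scale[OF subspace_cd_carrier]

lemma cd_carrier_mono: "m \<le> n \<Longrightarrow> x \<in> cd_carrier m \<Longrightarrow> x \<in> cd_carrier n"
proof -
  assume "m \<le> n" "x \<in> cd_carrier m"
  moreover from \<open>m \<le> n\<close> have "(2::nat) ^ m \<le> 2 ^ n" by simp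
  ultimately show ?thesis unfolding cd_carrier_def by (blast intro: order_trans)
qed

lemma cd_basis_0_in_carrier: "cd_basis 0 \<in> cd_carrier n"
  by (simp add: cd_carrier_def cd_basis_def)

lemma cd_conj_in_carrier: "x \<in> cd_carrier n \<Longrightarrow> cd_conj n x \<in> cd_carrier n"
  by (cases n) (auto simp: cd_join_in_carrier)

lemma cd_mult_in_carrier [simp]: "cd_mult n x y \<in> cd_carrier n"
  by (cases n) (auto simp: cd_carrier_def cd_join_def Let_def)

lemma cd_conj_add: "cd_conj n (x + y) = cd_conj n x + cd_conj n y"
proof (induction n arbitrary: x y)
  case (Suc n)
  have "cd_conj (Suc n) (x + y) = cd_join n (cd_conj n (cd_lo n x) + cd_conj n (cd_lo n y))
      (- cd_hi n x + - cd_hi n y)"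
    by (simp only: cd_conj.simps cd_parts_add(1,2) Suc.IH minus_add_distrib)
  then show ?case by (simp only: cd_parts_add(3) cd_conj.simps)
qed simp

lemma cd_conj_scaleR: "cd_conj n (r *\<^sub>R x) = r *\<^sub>R cd_conj n x"
proof (induction n arbitrary: x)
  case (Suc n)
  have "cd_conj (Suc n) (r *\<^sub>R x) = cd_join n (r *\<^sub>R cd_conj n (cd_lo n x)) (r *\<^sub>R (- cd_hi n x))"
    by (simp add: cd_parts_scaleR(1,2) Suc)
  then show ?case by (simp only: cd_parts_scaleR(3) cd_conj.simps)
qed simp

lemma cd_conj_diff: "cd_conj n (x - y) = cd_conj n x - cd_conj n y"
  using cd_conj_add[of n x "- y"] by (simp add: cd_conj_minus)

lemma cd_mult_add_left: "cd_mult n (x + y) z = cd_mult n x z + cd_mult n y z"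
  and cd_mult_add_right: "cd_mult n z (x + y) = cd_mult n z x + cd_mult n z y"
proof (induction n arbitrary: x y z)
  case 0
  { case 1 show ?case by (auto simp: fun_eq_iff algebra_simps) }
  { case 2 show ?case by (auto simp: fun_eq_iff algebra_simps) }
next
  case (Suc n)
  { case 1 show ?case
      by (simp add: cd_parts_add(1,2) Suc.IH Let_def del: plus_fun_apply flip: cd_parts_add(3))
        (simp add: algebra_simps del: plus_fun_apply) }
  { case 2 show ?case
      by (simp add: cd_parts_add(1,2) cd_conj_add Suc.IH Let_def del: plus_fun_apply flip: cd_parts_add(3))
        (simp add: algebra_simps del: plus_fun_apply) }
qed

lemma cd_mult_scaleR_left: "cd_mult n (r *\<^sub>R x) y = r *\<^sub>R cd_mult n x y"
  and cd_mult_scaleR_right: "cd_mult n x (r *\<^sub>R y) = r *\<^sub>R cd_mult n x y"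
proof (induction n arbitrary: x y)
  case 0
  { case 1 show ?case by (auto simp: fun_eq_iff scaleR_fun_def) }
  { case 2 show ?case by (auto simp: fun_eq_iff scaleR_fun_def) }
next
  case (Suc n)
  { case 1 show ?case
      by (simp add: cd_parts_scaleR(1,2) Suc.IH Let_def flip: cd_parts_scaleR(3) scaleR_add_right scaleR_diff_right) }
  { case 2 show ?case
      by (simp add: cd_parts_scaleR(1,2) cd_conj_scaleR Suc.IH Let_def flip: cd_parts_scaleR(3) scaleR_add_right scaleR_diff_right) }
qed

lemma cd_mult_diff_left: "cd_mult n (x - y) z = cd_mult n x z - cd_mult n y z"
  and cd_mult_diff_right: "cd_mult n z (x - y) = cd_mult n z x - cd_mult n z y"
  using cd_mult_add_left[of n x "- y" z] cd_mult_add_right[of n z x "- y"]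
  by (simp_all add: cd_mult_minus)

lemma cd_conj_conj: "x \<in> cd_carrier n \<Longrightarrow> cd_conj n (cd_conj n x) = x"
  by (induction n arbitrary: x)
    (simp_all add: cd_lo_join cd_hi_join cd_conj_in_carrier cd_carrier_minus cd_join_lo_hi)

lemmas cd_carrier_closed = cd_carrier_add cd_carrier_diff cd_carrier_minus cd_conj_in_carrier

text \<open>Induction is needed only for the lower halves, where the terms \<open>a c\<close> and
  \<open>conj d b\<close> are reversed. The upper halves agree by bilinearity and because
  conjugation is an involution.\<close>

lemma cd_conj_mult: "cd_conj n (cd_mult n x y) = cd_mult n (cd_conj n y) (cd_conj n x)"
  by (induction n arbitrary: x y)
    (simp_all add: Let_def cd_lo_join cd_hi_join cd_carrier_closed cd_conj_diff cd_conj_minus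
      cd_mult_minus cd_conj_conj add.commute mult.commute cong: if_cong)

section \<open>Real parts of products, that is, their coordinates at 0\<close>

lemma cd_conj_at_0 [simp]: "cd_conj n x 0 = x 0"
  by (induction n arbitrary: x) (simp_all add: cd_join_def cd_lo_def)

lemma cd_mult_Suc_at_0:
  "cd_mult (Suc n) x y 0 =
     cd_mult n (cd_lo n x) (cd_lo n y) 0 - cd_mult n (cd_conj n (cd_hi n y)) (cd_hi n x) 0"
  by (simp add: Let_def cd_join_def)

text \<open>Conjugation fixes the real part and reverses products, so \<open>conj d b\<close> and
  \<open>conj b d\<close> have the same real part. The lower halves commute by induction.\<close>

lemma cd_mult_commute_at_0: "cd_mult n x y 0 = cd_mult n y x 0"
proof (induction n arbitrary: x y)
  case (Suc n)
  have "cd_mult n (cd_conj n (cd_hi n y)) (cd_hi n x) 0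
      = cd_conj n (cd_mult n (cd_conj n (cd_hi n y)) (cd_hi n x)) 0"
    by simp
  also have "\<dots> = cd_mult n (cd_conj n (cd_hi n x)) (cd_hi n y) 0"
    by (simp add: cd_conj_mult cd_conj_conj del: cd_conj_at_0)
  finally show ?case
    using Suc.IH[of "cd_lo n x" "cd_lo n y"] by (simp only: cd_mult_Suc_at_0)
qed (simp add: mult.commute)

text \<open>The product is not associative from level 3 on, but its real part is. Both sides expand
  into the real parts of four triple products one level below, and these match in pairs up to
  reassociation and cyclic rotation. Condition (1) on the inner product rests on this.\<close>

lemma cd_mult_assoc_at_0: "cd_mult n (cd_mult n x y) z 0 = cd_mult n x (cd_mult n y z) 0"
proof (induction n arbitrary: x y z)
  case (Suc n)
  \<comment> \<open>Cyclic invariance: commute \<open>w\<close> to the front, then reassociate by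
    induction.\<close>
  have rotate: "cd_mult n (cd_mult n u v) w 0 = cd_mult n (cd_mult n w u) v 0" for u v w
    using Suc.IH[of w u v] cd_mult_commute_at_0[of n "cd_mult n u v" w] by simp
  let ?a = "cd_lo n x" and ?b = "cd_hi n x" and ?c = "cd_lo n y"
  let ?d = "cd_hi n y" and ?e = "cd_lo n z" and ?f = "cd_hi n z"
  have "cd_mult (Suc n) (cd_mult (Suc n) x y) z 0 =
     cd_mult n (cd_mult n ?a ?c - cd_mult n (cd_conj n ?d) ?b) ?e 0 -
     cd_mult n (cd_conj n ?f) (cd_mult n ?d ?a + cd_mult n ?b (cd_conj n ?c)) 0"
    by (simp add: Let_def cd_mult_Suc_at_0 cd_lo_join cd_hi_join cd_carrier_closed del: cd_mult.simps(1)) (simp add: cd_join_def)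
  moreover have "cd_mult (Suc n) x (cd_mult (Suc n) y z) 0 =
     cd_mult n ?a (cd_mult n ?c ?e - cd_mult n (cd_conj n ?f) ?d) 0 -
     cd_mult n (cd_conj n (cd_mult n ?f ?c + cd_mult n ?d (cd_conj n ?e))) ?b 0"
    by (simp add: Let_def cd_mult_Suc_at_0 cd_lo_join cd_hi_join cd_carrier_closed del: cd_mult.simps(1)) (simp add: cd_join_def)
  ultimately show ?case
    using Suc.IH[of ?a ?c ?e] rotate[of "cd_conj n ?d" ?b ?e]
      Suc.IH[of "cd_conj n ?f" ?d ?a] cd_mult_commute_at_0[of n ?a "cd_mult n (cd_conj n ?f) ?d"]
      Suc.IH[of "cd_conj n ?f" ?b "cd_conj n ?c"] rotate[of ?b "cd_conj n ?c" "cd_conj n ?f"]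
      rotate[of "cd_conj n ?c" "cd_conj n ?f" ?b] rotate[of ?e "cd_conj n ?d" ?b]
    by (simp add: cd_mult_diff_left cd_mult_diff_right cd_mult_add_left cd_mult_add_right
        cd_conj_add cd_conj_mult cd_conj_conj)
qed simp

section \<open>The sum and the product of an element and its conjugate\<close>

lemma cd_join_scaleR_basis_0:
  "cd_join n (r *\<^sub>R cd_basis 0) 0 = r *\<^sub>R cd_basis 0"
  using cd_join_basis(1)[of 0 n] cd_parts_scaleR(3)[of n r "cd_basis 0" 0] by simp

lemma cd_add_conj: "x \<in> cd_carrier n \<Longrightarrow> x + cd_conj n x = (2 * x 0) *\<^sub>R cd_basis 0"
proof (induction n arbitrary: x)
  case 0
  then show ?case by (auto simp: cd_carrier_def cd_basis_def fun_eq_iff scaleR_fun_def)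
next
  case (Suc n)
  have "x + cd_conj (Suc n) x
      = cd_join n (cd_lo n x) (cd_hi n x) + cd_join n (cd_conj n (cd_lo n x)) (- cd_hi n x)"
    using Suc.prems by (simp add: cd_join_lo_hi)
  also have "\<dots> = cd_join n (cd_lo n x + cd_conj n (cd_lo n x)) 0"
    by (simp flip: cd_parts_add(3))
  also have "\<dots> = (2 * x 0) *\<^sub>R cd_basis 0"
    by (subst Suc.IH) (simp_all add: cd_join_scaleR_basis_0, simp add: cd_lo_def)
  finally show ?case .
qed

lemma oct_Re_eq: "x \<in> octonions \<Longrightarrow> oct_Re x = x 0 *\<^sub>R cd_basis 0"
  by (simp add: oct_Re_def cd_add_conj)

lemma sum_lessThan_add:
  "(\<Sum>i<m + k. g i) = (\<Sum>i<m. g i) + (\<Sum>i<k. g (m + i))" for g :: "nat \<Rightarrow> 'a :: comm_monoid_add"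
  by (induction k) (simp_all add: add.assoc)

text \<open>For \<open>x = a + b e\<close> the upper half of the product cancels and the lower half
  is \<open>a conj a + conj b b\<close>. The second term has the factors in the other order, so the
  two orders are proved together. Both sides see only the coordinates below \<open>2 ^ n\<close>,
  hence the identities hold on the whole type, as \<open>oct_sum_nonneg\<close> requires.\<close>

lemma cd_mult_conj: "cd_mult n x (cd_conj n x) = (\<Sum>i<2 ^ n. (x i)\<^sup>2) *\<^sub>R cd_basis 0"
  and cd_conj_mult_self: "cd_mult n (cd_conj n x) x = (\<Sum>i<2 ^ n. (x i)\<^sup>2) *\<^sub>R cd_basis 0"
proof (induction n arbitrary: x)
  case 0
  { case 1 show ?case
      by (auto simp: cd_basis_def scaleR_fun_def fun_eq_iff power2_eq_square) }
  { case 2 show ?case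
      by (auto simp: cd_basis_def scaleR_fun_def fun_eq_iff power2_eq_square) }
next
  case (Suc n)
  have norm: "(\<Sum>i<2 ^ Suc n. (x i)\<^sup>2)
      = (\<Sum>i<2 ^ n. (cd_lo n x i)\<^sup>2) + (\<Sum>i<2 ^ n. (cd_hi n x i)\<^sup>2)" for x :: cd
    by (simp add: mult_2 sum_lessThan_add cd_lo_def cd_hi_def)
  { case 1 show ?case unfolding norm
      by (simp add: Let_def cd_lo_join cd_hi_join cd_carrier_closed cd_conj_minus cd_mult_minus
        cd_conj_conj Suc.IH cd_join_scaleR_basis_0 flip: scaleR_add_left) }
  { case 2 show ?case unfolding norm
      by (simp add: Let_def cd_lo_join cd_hi_join cd_carrier_closed cd_conj_minus cd_mult_minus
        cd_conj_conj Suc.IH cd_join_scaleR_basis_0 flip: scaleR_add_left) }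
qed

section \<open>The octonions in coordinates\<close>

lemma oct_mult_coords:
  "oct_mult x y 0 = x 0 * y 0 - x 1 * y 1 - x 2 * y 2 - x 3 * y 3 - x 4 * y 4 - x 5 * y 5 - x 6 * y 6 - x 7 * y 7"
  "oct_mult x y 1 = x 0 * y 1 + x 1 * y 0 + x 2 * y 3 - x 3 * y 2 + x 4 * y 5 - x 5 * y 4 - x 6 * y 7 + x 7 * y 6"
  "oct_mult x y 2 = x 0 * y 2 - x 1 * y 3 + x 2 * y 0 + x 3 * y 1 + x 4 * y 6 + x 5 * y 7 - x 6 * y 4 - x 7 * y 5"
  "oct_mult x y 3 = x 0 * y 3 + x 1 * y 2 - x 2 * y 1 + x 3 * y 0 + x 4 * y 7 - x 5 * y 6 + x 6 * y 5 - x 7 * y 4"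
  "oct_mult x y 4 = x 0 * y 4 - x 1 * y 5 - x 2 * y 6 - x 3 * y 7 + x 4 * y 0 + x 5 * y 1 + x 6 * y 2 + x 7 * y 3"
  "oct_mult x y 5 = x 0 * y 5 + x 1 * y 4 - x 2 * y 7 + x 3 * y 6 - x 4 * y 1 + x 5 * y 0 - x 6 * y 3 + x 7 * y 2"
  "oct_mult x y 6 = x 0 * y 6 + x 1 * y 7 + x 2 * y 4 - x 3 * y 5 - x 4 * y 2 + x 5 * y 3 + x 6 * y 0 - x 7 * y 1"
  "oct_mult x y 7 = x 0 * y 7 - x 1 * y 6 + x 2 * y 5 + x 3 * y 4 - x 4 * y 3 - x 5 * y 2 + x 6 * y 1 + x 7 * y 0"
  by (simp_all add: numeral_3_eq_3 Let_def cd_join_def cd_lo_def cd_hi_def)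

lemma oct_eqI:
  assumes "x \<in> octonions" "y \<in> octonions"
    and "x 0 = y 0" "x 1 = y 1" "x 2 = y 2" "x 3 = y 3" "x 4 = y 4" "x 5 = y 5" "x 6 = y 6" "x 7 = y 7"
  shows "x = y"
proof
  fix i :: nat
  consider "i \<ge> 8" | "i = 0" | "i = 1" | "i = 2" | "i = 3" | "i = 4" | "i = 5" | "i = 6" | "i = 7"
    by linarith
  then show "x i = y i"
    using assms by cases (auto simp: cd_carrier_def)
qed

text \<open>Coordinate by coordinate this is a polynomial identity. Deleting
  \<open>One_nat_def\<close> keeps the index \<open>1\<close> in the form in which
  \<open>oct_mult_coords\<close> states it.\<close>

lemma oct_mult_left_alternative: "oct_mult p (oct_mult p x) = oct_mult (oct_mult p p) x"
  by (rule oct_eqI) (simp_all add: oct_mult_coords algebra_simps del: One_nat_def)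

section \<open>The action of the octonions\<close>

text \<open>At these levels an octonion has upper half 0, so two of the four products in the
  doubling formula vanish. On the upper half of \<open>x\<close> left multiplication by
  \<open>p\<close> becomes right multiplication.\<close>

lemma cd_mult_octonion:
  assumes "3 \<le> n" "p \<in> octonions"
  shows "cd_mult (Suc n) p x = cd_join n (cd_mult n p (cd_lo n x)) (cd_mult n (cd_hi n x) p)"
proof -
  have p: "p \<in> cd_carrier n" using assms cd_carrier_mono by blast
  have "cd_lo n p = p" "cd_hi n p = 0"
    using p by (auto simp: cd_lo_def cd_hi_def cd_carrier_def fun_eq_iff not_less)
  then show ?thesis by (simp add: Let_def cd_mult_zero)
qed

lemma cd_conj_octonion:
  assumes "3 \<le> n" "p \<in> octonions"
  shows "cd_conj n p = oct_conj p"
  using assms(1)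
proof (induction n rule: dec_induct)
  case (step n)
  have p: "p \<in> cd_carrier n" using step assms cd_carrier_mono by blast
  have "cd_lo n p = p" "cd_hi n p = 0"
    using p by (auto simp: cd_lo_def cd_hi_def cd_carrier_def fun_eq_iff not_less)
  moreover have "cd_join n (oct_conj p) 0 = oct_conj p"
    using cd_carrier_mono[OF step(1) cd_conj_in_carrier[OF assms(2)]]
    by (auto simp: cd_join_def cd_carrier_def fun_eq_iff not_less)
  ultimately show ?case using step by simp
qed simp

text \<open>Higher levels are not alternative, but the square of an octonion still acts correctly.
  The lower half is the induction hypothesis itself. On the upper half, conjugation turns right
  multiplication by \<open>p\<close> into left multiplication by its conjugate, to which the
  induction hypothesis applies; hence \<open>p\<close> is generalized.\<close>

lemma cd_mult_octonion_left_alternative: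
  assumes "3 \<le> n" "p \<in> octonions" "x \<in> cd_carrier n"
  shows "cd_mult n p (cd_mult n p x) = cd_mult n (oct_mult p p) x"
  using assms
proof (induction n arbitrary: p x rule: dec_induct)
  case base
  then show ?case by (simp add: oct_mult_left_alternative)
next
  case (step n)
  have pn: "p \<in> cd_carrier n" using step.hyps step.prems cd_carrier_mono by blast
  let ?b = "cd_hi n x" and ?q = "oct_conj p"
  have q: "?q \<in> octonions" using step.prems by (simp add: cd_conj_in_carrier)
  have conj_p: "cd_conj n ?q = p" "cd_conj n (oct_mult ?q ?q) = oct_mult p p"
    using cd_conj_octonion[OF step.hyps(1) q] cd_conj_octonion[OF step.hyps(1) cd_mult_in_carrier[of 3 ?q ?q]]
      step.prems by (simp_all add: cd_conj_conj cd_conj_mult)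
  have "cd_mult n (cd_mult n ?b p) p = cd_conj n (cd_mult n ?q (cd_mult n ?q (cd_conj n ?b)))"
    by (simp add: cd_conj_mult cd_conj_conj conj_p)
  also have "\<dots> = cd_mult n ?b (oct_mult p p)"
    using step.IH[OF q, of "cd_conj n ?b"]
    by (simp add: cd_conj_mult cd_conj_conj conj_p cd_conj_in_carrier)
  finally have "cd_mult n (cd_mult n ?b p) p = cd_mult n ?b (oct_mult p p)" .
  then show ?case using step
    by (simp add: cd_mult_octonion cd_lo_join cd_hi_join del: cd_mult.simps)
qed

section \<open>The projection onto the octonions\<close>

lemma oct_proj_in_octonions: "oct_proj x \<in> octonions"
  by (simp add: oct_proj_def cd_carrier_def)

lemma oct_proj_add: "oct_proj (x + y) = oct_proj x + oct_proj y"
  by (auto simp: oct_proj_def fun_eq_iff)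

lemma oct_proj_scaleR: "oct_proj (r *\<^sub>R x) = r *\<^sub>R oct_proj x"
  by (auto simp: oct_proj_def fun_eq_iff scaleR_fun_def)

lemma oct_proj_octonion: "x \<in> octonions \<Longrightarrow> oct_proj x = x"
  by (auto simp: oct_proj_def fun_eq_iff cd_carrier_def)

lemma oct_proj_scaleR_basis_0: "oct_proj (r *\<^sub>R cd_basis 0) = r *\<^sub>R cd_basis 0"
  by (auto simp: oct_proj_def fun_eq_iff scaleR_fun_def cd_basis_def)

lemma oct_proj_join:
  assumes "3 \<le> n"
  shows "oct_proj (cd_join n a b) = oct_proj a"
proof -
  have "(2::nat) ^ 3 \<le> 2 ^ n" using assms by (intro power_increasing) auto
  then show ?thesis by (auto simp: oct_proj_def cd_join_def fun_eq_iff)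
qed

lemma oct_proj_lo: "3 \<le> n \<Longrightarrow> oct_proj (cd_lo n x) = oct_proj x"
proof -
  assume "3 \<le> n"
  then have "(2::nat) ^ 3 \<le> 2 ^ n" by (intro power_increasing) auto
  then show ?thesis by (auto simp: oct_proj_def cd_lo_def fun_eq_iff)
qed

lemma oct_proj_conj: "3 \<le> n \<Longrightarrow> x \<in> cd_carrier n \<Longrightarrow> oct_proj (cd_conj n x) = oct_conj (oct_proj x)"
proof (induction n arbitrary: x rule: dec_induct)
  case base
  then show ?case by (simp add: oct_proj_octonion cd_conj_in_carrier)
next
  case (step n)
  then show ?case by (simp add: oct_proj_join oct_proj_lo)
qed

text \<open>Multiplication by an octonion mixes no upper half into the lower one, so the real part
  of \<open>p x\<close> depends only on the octonion part of \<open>x\<close>. This carries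
  condition (1) from the octonions to level \<open>n\<close>.\<close>

lemma oct_mult_oct_proj_at_0:
  assumes "3 \<le> n" "p \<in> octonions" "x \<in> cd_carrier n"
  shows "oct_mult p (oct_proj x) 0 = cd_mult n p x 0"
  using assms(1,3)
proof (induction n arbitrary: x rule: dec_induct)
  case base
  then show ?case by (simp add: oct_proj_octonion)
next
  case (step n)
  have "cd_mult (Suc n) p x 0 = cd_mult n p (cd_lo n x) 0"
    using step assms(2) by (simp add: cd_mult_octonion cd_join_def del: cd_mult.simps)
  also have "\<dots> = oct_mult p (oct_proj x) 0"
    using step by (simp add: oct_proj_lo flip: step.IH)
  finally show ?case by simp
qed


section \<open>The Cayley--Dickson algebras as Hilbert modules\<close>

lemma onorm_cd_module: "onorm (cd_module n) x = L2_set x {..<2 ^ n}"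
  by (simp add: onorm_def cd_module_def L2_set_def cd_mult_conj oct_proj_scaleR_basis_0)
    (simp add: scaleR_fun_def cd_basis_def)

lemma Metric_space_cd_module:
  "Metric_space (cd_carrier n) (\<lambda>x y. onorm (cd_module n) (x - y))"
proof
  fix x y z :: cd
  show "0 \<le> onorm (cd_module n) (x - y)"
    by (simp add: onorm_cd_module)
  show "onorm (cd_module n) (x - y) = onorm (cd_module n) (y - x)"
    by (simp add: onorm_cd_module L2_set_def power2_commute)
  assume "x \<in> cd_carrier n" "y \<in> cd_carrier n"
  \<comment> \<open>The norm sees only the coordinates below \<open>2 ^ n\<close>; membership in the
    carrier settles the others.\<close>
  then have "x i = y i" if "\<not> i < 2 ^ n" for i
    using that by (simp add: cd_carrier_def)
  then show "onorm (cd_module n) (x - y) = 0 \<longleftrightarrow> x = y"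
    by (auto simp: onorm_cd_module fun_eq_iff L2_set_eq_0_iff)
  have "L2_set (x - z) {..<2 ^ n} = L2_set (\<lambda>i. (x - y) i + (y - z) i) {..<2 ^ n}"
    by (simp add: L2_set_def)
  then show "onorm (cd_module n) (x - z) \<le> onorm (cd_module n) (x - y) + onorm (cd_module n) (y - z)"
    by (simp only: onorm_cd_module L2_set_triangle_ineq)
qed

lemma mcomplete_cd_module:
  "Metric_space.mcomplete (cd_carrier n) (\<lambda>x y. onorm (cd_module n) (x - y))"
proof -
  interpret Metric_space "cd_carrier n" "\<lambda>x y. onorm (cd_module n) (x - y)"
    by (rule Metric_space_cd_module)
  show ?thesis
    unfolding mcomplete_def
  proof (intro allI impI)
    fix \<sigma> assume Cauchy: "MCauchy \<sigma>"
    have "Cauchy (\<lambda>k. \<sigma> k i)" if "i < 2 ^ n" for i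
    proof (rule CauchyI)
      fix e :: real assume "0 < e"
      with Cauchy obtain N where
        N: "\<And>k l. N \<le> k \<Longrightarrow> N \<le> l \<Longrightarrow> onorm (cd_module n) (\<sigma> k - \<sigma> l) < e"
        unfolding MCauchy_def by blast
      \<comment> \<open>Inserting absolute values bounds the modulus of a single coordinate by the
        norm; they disappear in the squares.\<close>
      have "norm (\<sigma> k i - \<sigma> l i) < e" if "N \<le> k" "N \<le> l" for k l
        using N[OF that] member_le_L2_set[of "{..<2 ^ n}" i "\<lambda>i. \<bar>(\<sigma> k - \<sigma> l) i\<bar>"] \<open>i < 2 ^ n\<close>
        by (simp add: onorm_cd_module L2_set_def)
      then show "\<exists>N. \<forall>k\<ge>N. \<forall>l\<ge>N. norm (\<sigma> k i - \<sigma> l i) < e"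
        by blast
    qed
    then have lim: "(\<lambda>k. \<sigma> k i) \<longlonglongrightarrow> lim (\<lambda>k. \<sigma> k i)" if "i < 2 ^ n" for i
      using that Cauchy_convergent convergent_LIMSEQ_iff by blast
    \<comment> \<open>The limit is taken coordinatewise and is 0 from \<open>2 ^ n\<close> on, so
      that it lies in the carrier.\<close>
    define x where "x = (\<lambda>i. if i < 2 ^ n then lim (\<lambda>k. \<sigma> k i) else 0)"
    \<comment> \<open>The limit 0 is written unevaluated, in the shape that the limit rules
      produce.\<close>
    have "(\<lambda>k. L2_set (\<sigma> k - x) {..<2 ^ n}) \<longlonglongrightarrow> sqrt (\<Sum>i<2 ^ n. (x i - x i)\<^sup>2)"
      unfolding L2_set_def minus_apply
      by (intro tendsto_intros) (simp add: x_def lim)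
    then have "(\<lambda>k. onorm (cd_module n) (\<sigma> k - x)) \<longlonglongrightarrow> 0"
      by (simp add: onorm_cd_module)
    moreover have "x \<in> cd_carrier n" by (simp add: x_def cd_carrier_def)
    moreover have "range \<sigma> \<subseteq> cd_carrier n" using Cauchy by (simp add: MCauchy_def)
    ultimately have "limitin mtopology \<sigma> x sequentially"
      by (auto simp: limitin_metric_dist_null image_subset_iff)
    then show "\<exists>x. limitin mtopology \<sigma> x sequentially" by blast
  qed
qed

lemma sum_squares_eq_0_iff_cd:
  "x \<in> cd_carrier n \<Longrightarrow> (\<Sum>i<2 ^ n. (x i)\<^sup>2) = 0 \<longleftrightarrow> x = 0"
  by (auto simp: cd_carrier_def sum_nonneg_eq_0_iff fun_eq_iff)
    (metis lessThan_iff not_less)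

lemma hilbert_left_O_module_cd_module:
  assumes "3 \<le> n"
  shows "hilbert_left_O_module (cd_module n)"
proof
  show "subspace (ocarrier (cd_module n))"
    by (simp add: cd_module_def subspace_cd_carrier)
  fix p q x y z :: cd and r :: real
  assume x: "x \<in> ocarrier (cd_module n)"
  then have xn: "x \<in> cd_carrier n" by (simp add: cd_module_def)
  show "oact (cd_module n) (cd_basis 0) x = x"
    using xn by (simp add: cd_module_def cd_mult_one_left)
  show "oact (cd_module n) p x \<in> ocarrier (cd_module n)"
    by (simp add: cd_module_def)
  show "oact (cd_module n) p (r *\<^sub>R x) = r *\<^sub>R oact (cd_module n) p x"
    by (simp add: cd_module_def cd_mult_scaleR_right)
  show "oact (cd_module n) (r *\<^sub>R p) x = r *\<^sub>R oact (cd_module n) p x"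
    by (simp add: cd_module_def cd_mult_scaleR_left)
  show "oact (cd_module n) p (x + y) = oact (cd_module n) p x + oact (cd_module n) p y"
    by (simp add: cd_module_def cd_mult_add_right)
  show "oact (cd_module n) (p + q) x = oact (cd_module n) p x + oact (cd_module n) q x"
    by (simp add: cd_module_def cd_mult_add_left)
  show "oact (cd_module n) p (oact (cd_module n) p x) = oact (cd_module n) (oct_mult p p) x"
    if "p \<in> octonions"
    using that xn assms by (simp add: cd_module_def cd_mult_octonion_left_alternative)
  show "oinner (cd_module n) x y \<in> octonions"
    by (simp add: cd_module_def oct_proj_in_octonions)
  show "oinner (cd_module n) (x + y) z = oinner (cd_module n) x z + oinner (cd_module n) y z"
    by (simp add: cd_module_def cd_mult_add_left oct_proj_add)
  show "oinner (cd_module n) x (y + z) = oinner (cd_module n) x y + oinner (cd_module n) x z"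
    by (simp add: cd_module_def cd_mult_add_right cd_conj_add oct_proj_add)
  show "oinner (cd_module n) (r *\<^sub>R x) y = r *\<^sub>R oinner (cd_module n) x y"
    by (simp add: cd_module_def cd_mult_scaleR_left oct_proj_scaleR)
  show "oinner (cd_module n) x (r *\<^sub>R y) = r *\<^sub>R oinner (cd_module n) x y"
    by (simp add: cd_module_def cd_conj_scaleR cd_mult_scaleR_right oct_proj_scaleR)
  show "oct_Re (oinner (cd_module n) (oact (cd_module n) p x) y
      - oct_mult p (oinner (cd_module n) x y)) = 0" if "p \<in> octonions"
  proof -
    \<comment> \<open>Drop the projection under the real part, then reassociate there.\<close>
    have "oct_mult p (oct_proj (cd_mult n x (cd_conj n y))) 0
        = cd_mult n (cd_mult n p x) (cd_conj n y) 0"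
      using assms that by (simp add: oct_mult_oct_proj_at_0 cd_mult_assoc_at_0)
    then have "(oinner (cd_module n) (oact (cd_module n) p x) y
        - oct_mult p (oinner (cd_module n) x y)) 0 = 0"
      by (simp add: cd_module_def) (simp add: oct_proj_def)
    then show ?thesis
      by (subst oct_Re_eq) (simp_all add: cd_module_def cd_carrier_diff oct_proj_in_octonions del: minus_apply)
  qed
  show "\<exists>r\<ge>0. oinner (cd_module n) x x = r *\<^sub>R cd_basis 0"
    by (auto simp: cd_module_def cd_mult_conj oct_proj_scaleR_basis_0 intro!: exI[of _ "\<Sum>i<2 ^ n. (x i)\<^sup>2"] sum_nonneg)
  have "cd_basis 0 \<noteq> 0" by (simp add: cd_basis_def fun_eq_iff)
  then show "oinner (cd_module n) x x = 0 \<longleftrightarrow> x = 0"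
    using xn by (simp add: cd_module_def cd_mult_conj oct_proj_scaleR_basis_0 sum_squares_eq_0_iff_cd)
  show "oinner (cd_module n) x y = oct_conj (oinner (cd_module n) y x)"
    if "y \<in> ocarrier (cd_module n)"
    using that xn assms by (simp add: cd_module_def cd_conj_mult cd_conj_conj flip: oct_proj_conj)
next
  show "Metric_space.mcomplete (ocarrier (cd_module n)) (\<lambda>u v. onorm (cd_module n) (u - v))"
    using mcomplete_cd_module by (simp add: cd_module_def)
qed

section \<open>Transfer along linear isomorphisms\<close>

text \<open>A Cauchy sequence is pulled back along \<open>f\<close>, and the image of its limit is a
  limit.\<close>

lemma mcomplete_isometry:
  assumes A: "Metric_space A d" and B: "Metric_space B e" and f: "bij_betw f A B"
    and iso: "\<And>x y. x \<in> A \<Longrightarrow> y \<in> A \<Longrightarrow> e (f x) (f y) = d x y"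
    and complete: "Metric_space.mcomplete A d"
  shows "Metric_space.mcomplete B e"
  unfolding Metric_space.mcomplete_def[OF B]
proof (intro allI impI)
  interpret A: Metric_space A d by (rule A)
  interpret B: Metric_space B e by (rule B)
  fix \<sigma> assume \<sigma>: "B.MCauchy \<sigma>"
  define \<tau> where "\<tau> k = inv_into A f (\<sigma> k)" for k
  have "\<sigma> k \<in> B" for k using \<sigma> by (auto simp: B.MCauchy_def)
  then have \<tau>: "\<tau> k \<in> A" "f (\<tau> k) = \<sigma> k" for k
    using f by (auto simp: \<tau>_def bij_betw_def inv_into_into f_inv_into_f)
  have "A.MCauchy \<tau>"
    using \<sigma> \<tau>(1) unfolding A.MCauchy_def B.MCauchy_def
    by (auto simp: iso simp flip: \<tau>(2))
  then obtain x where "limitin A.mtopology \<tau> x sequentially"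
    using complete A.mcomplete_def by blast
  then have "x \<in> A" "(\<lambda>k. d (\<tau> k) x) \<longlonglongrightarrow> 0"
    by (auto simp: A.limitin_metric_dist_null)
  then have "limitin B.mtopology \<sigma> (f x) sequentially"
    using \<tau>(1) f by (auto simp: B.limitin_metric_dist_null iso bij_betw_apply simp flip: \<tau>(2))
  then show "\<exists>x. limitin B.mtopology \<sigma> x sequentially" ..
qed

text \<open>Linearity is recorded explicitly because the map serves to transfer the module axioms to
  \<open>N\<close>, before \<open>N\<close> is known to satisfy any.\<close>

definition is_linear_O_iso ::
  "('v :: real_vector \<Rightarrow> 'w :: real_vector) \<Rightarrow> ('v, 'm) omod_scheme \<Rightarrow> ('w, 'n) omod_scheme \<Rightarrow> bool" where
  "is_linear_O_iso f M N \<longleftrightarrow> is_hilbert_O_iso f M N \<and>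
     (\<forall>x\<in>ocarrier M. \<forall>y\<in>ocarrier M. f (x + y) = f x + f y) \<and>
     (\<forall>r. \<forall>x\<in>ocarrier M. f (r *\<^sub>R x) = r *\<^sub>R f x)"

text \<open>
  The last two hypotheses range over the whole type because the locale \<open>Metric_space\<close> requires a
  symmetric nonnegative distance outside of the carrier as well.
\<close>

lemma hilbert_left_O_module_iso:
  assumes "hilbert_left_O_module M" and f: "is_linear_O_iso f M N"
    and metric: "Metric_space (ocarrier M) (\<lambda>u v. onorm M (u - v))"
    and even: "\<And>z. oinner N (- z) (- z) = oinner N z z"
    and pos: "\<And>z. 0 \<le> oinner N z z 0"
  shows "hilbert_left_O_module N"
proof -
  interpret M: hilbert_left_O_module M by (rule assms(1))
  have N: "ocarrier N = f ` ocarrier M" and inj: "inj_on f (ocarrier M)"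
    and bij: "bij_betw f (ocarrier M) (ocarrier N)"
    using f by (auto simp: is_linear_O_iso_def is_hilbert_O_iso_def bij_betw_def)
  have act: "oact N p (f x) = f (oact M p x)" if "p \<in> octonions" "x \<in> ocarrier M" for p x
    using f that by (auto simp: is_linear_O_iso_def is_hilbert_O_iso_def)
  have inner: "oinner N (f x) (f y) = oinner M x y" if "x \<in> ocarrier M" "y \<in> ocarrier M" for x y
    using f that by (auto simp: is_linear_O_iso_def is_hilbert_O_iso_def)
  have add: "f x + f y = f (x + y)" if "x \<in> ocarrier M" "y \<in> ocarrier M" for x y
    using f that by (auto simp: is_linear_O_iso_def)
  have scale: "r *\<^sub>R f x = f (r *\<^sub>R x)" if "x \<in> ocarrier M" for r x
    using f that by (auto simp: is_linear_O_iso_def)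
  note closed = subspace_add[OF M.subspace_carrier] subspace_scale[OF M.subspace_carrier]
    subspace_0[OF M.subspace_carrier] subspace_diff[OF M.subspace_carrier]
  have zero: "f 0 = 0" using scale[OF closed(3), of 0] by simp
  have "f (- y) = - f y" if "y \<in> ocarrier M" for y
    using scale[OF that, of "-1"] by simp
  then have diff: "f x - f y = f (x - y)" if "x \<in> ocarrier M" "y \<in> ocarrier M" for x y
    using add[of x "- y"] that by (simp add: subspace_neg[OF M.subspace_carrier])
  have norm: "onorm N (f x - f y) = onorm M (x - y)" if "x \<in> ocarrier M" "y \<in> ocarrier M" for x y
    using that by (simp add: onorm_def diff inner closed)
  have metric_N: "Metric_space (ocarrier N) (\<lambda>u v. onorm N (u - v))"
  proof
    interpret Metric_space "ocarrier M" "\<lambda>u v. onorm M (u - v)" by (rule metric)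
    fix x y z
    show "0 \<le> onorm N (x - y)" by (simp add: onorm_def pos)
    show "onorm N (x - y) = onorm N (y - x)" using even[of "x - y"] by (simp add: onorm_def)
    assume "x \<in> ocarrier N" "y \<in> ocarrier N"
    then show "onorm N (x - y) = 0 \<longleftrightarrow> x = y"
      using zero inj unfolding N by (metis (no_types, lifting) imageE norm)
    assume "z \<in> ocarrier N"
    then show "onorm N (x - z) \<le> onorm N (x - y) + onorm N (y - z)"
      using \<open>x \<in> ocarrier N\<close> \<open>y \<in> ocarrier N\<close> triangle by (auto simp: N norm)
  qed
  show ?thesis
  proof
    show "subspace (ocarrier N)"
      using imageI[OF closed(3), of f] unfolding N subspace_def by (auto simp: add scale closed zero)
    show "Metric_space.mcomplete (ocarrier N) (\<lambda>u v. onorm N (u - v))"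
      by (rule mcomplete_isometry[OF metric metric_N bij norm M.complete])
  next
    fix u assume "u \<in> ocarrier N"
    then obtain x where "x \<in> ocarrier M" "u = f x" by (auto simp: N)
    then show "oinner N u u = 0 \<longleftrightarrow> u = 0"
      using M.inner_eq_0_iff[of x] inj_on_eq_iff[OF inj, of x 0]
      by (simp add: inner closed zero)
  qed (auto simp: N act inner add scale closed M.act_closed M.act_add M.act_scaleR M.add_act
      M.scaleR_act M.one_act M.act_act M.inner_closed M.inner_add_left M.inner_add_right
      M.inner_scaleR_left M.inner_scaleR_right M.Re_inner_act M.inner_nonneg
      cd_carrier_add cd_carrier_scaleR cd_basis_0_in_carrier
      intro: M.inner_conj)
qed

text \<open>Injectivity comes from definiteness: if \<open>f x = f y\<close>, then
  \<open>x - y\<close> and 0 have the same image and therefore the same inner square.\<close>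

lemma is_linear_O_isoI:
  assumes "subspace (ocarrier M)"
    and inner_0: "\<And>x. x \<in> ocarrier M \<Longrightarrow> oinner M x x = 0 \<Longrightarrow> x = 0" "oinner M 0 0 = 0"
    and add: "\<And>x y. x \<in> ocarrier M \<Longrightarrow> y \<in> ocarrier M \<Longrightarrow> f (x + y) = f x + f y"
    and scale: "\<And>r x. x \<in> ocarrier M \<Longrightarrow> f (r *\<^sub>R x) = r *\<^sub>R f x"
    and closed: "\<And>x. x \<in> ocarrier M \<Longrightarrow> f x \<in> ocarrier N"
    and surj: "\<And>z. z \<in> ocarrier N \<Longrightarrow> \<exists>x\<in>ocarrier M. f x = z"
    and act: "\<And>p x. p \<in> octonions \<Longrightarrow> x \<in> ocarrier M \<Longrightarrow> f (oact M p x) = oact N p (f x)"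
    and inner: "\<And>x y. x \<in> ocarrier M \<Longrightarrow> y \<in> ocarrier M \<Longrightarrow> oinner N (f x) (f y) = oinner M x y"
  shows "is_linear_O_iso f M N"
proof -
  have "inj_on f (ocarrier M)"
  proof
    fix x y assume xy: "x \<in> ocarrier M" "y \<in> ocarrier M" "f x = f y"
    note closed = subspace_diff[OF assms(1) xy(1,2)] subspace_scale[OF assms(1) xy(2), of "-1"]
    have "f (x - y) = f x + (-1) *\<^sub>R f y"
      using add[OF xy(1) closed(2)] scale[OF xy(2), of "-1"] by simp
    also have "\<dots> = f 0"
      using xy scale[OF xy(1), of 0] by simp
    finally have "oinner M (x - y) (x - y) = oinner M 0 0"
      using inner closed(1) subspace_0[OF assms(1)] by metis
    then show "x = y" using inner_0 closed(1) by fastforce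
  qed
  then have "bij_betw f (ocarrier M) (ocarrier N)"
    using closed surj by (fastforce simp: bij_betw_def)
  then show ?thesis
    using add scale act inner by (simp add: is_linear_O_iso_def is_hilbert_O_iso_def)
qed

section \<open>The decomposition\<close>

text \<open>For upper halves \<open>b\<close> of \<open>s\<close> and \<open>d\<close> of
  \<open>w\<close>, the term \<open>conj d b\<close> is read as the inner product of
  \<open>conj d\<close> with \<open>conj b\<close>. The exchanged order is the twist of the inner
  product.\<close>

lemma cd_module_Suc_inner:
  assumes "3 \<le> n"
  shows "oinner (cd_module (Suc n)) s w = oinner (cd_module n) (cd_lo n s) (cd_lo n w)
    + oinner (cd_module n) (cd_conj n (cd_hi n w)) (cd_conj n (cd_hi n s))"
  using assms
  by (simp add: cd_module_def Let_def cd_lo_join cd_hi_join cd_carrier_closed cd_conj_minus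
      cd_mult_minus cd_conj_conj oct_proj_join flip: oct_proj_add)

text \<open>After conjugation the right multiplication on the upper half is the twisted left
  action.\<close>

lemma cd_conj_mult_octonion:
  assumes "3 \<le> n" "p \<in> octonions"
  shows "cd_conj n (cd_mult n x p) = cd_mult n (oct_conj p) (cd_conj n x)"
  by (simp add: cd_conj_mult cd_conj_octonion[OF assms])

lemmas oct_sum_defs = omod_sum_def omod_power_def oct_module_def oct_conj_module_def

text \<open>Together with \<open>oct_sum_nonneg\<close> this supplies the hypotheses
  \<open>even\<close> and \<open>pos\<close> of \<open>hilbert_left_O_module_iso\<close>.\<close>

lemma oct_sum_even:
  "oinner (oct_module ^\<^sub>O k \<oplus>\<^sub>O oct_conj_module ^\<^sub>O l) (- z) (- z)
    = oinner (oct_module ^\<^sub>O k \<oplus>\<^sub>O oct_conj_module ^\<^sub>O l) z z"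
  by (cases z) (simp add: oct_sum_defs cd_conj_minus cd_mult_minus)

lemma fun_sum_apply: "sum f A x = (\<Sum>i\<in>A. f i x)" for f :: "'a \<Rightarrow> 'b \<Rightarrow> real"
  by (induction A rule: infinite_finite_induct) auto

lemma oct_sum_nonneg:
  "0 \<le> oinner (oct_module ^\<^sub>O k \<oplus>\<^sub>O oct_conj_module ^\<^sub>O l) z z 0"
  by (cases z) (auto simp: oct_sum_defs cd_mult_conj fun_sum_apply scaleR_fun_def cd_basis_def
      intro!: add_nonneg_nonneg sum_nonneg)

lemma cd_module_linear_O_iso_4:
  "\<exists>f. is_linear_O_iso f (cd_module 4) (oct_module ^\<^sub>O 1 \<oplus>\<^sub>O oct_conj_module ^\<^sub>O 1)"
proof -
  \<comment> \<open>A tuple of length 1 has its only entry at index 0; the encoding demands zero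
    elsewhere.\<close>
  define f :: "cd \<Rightarrow> (nat \<Rightarrow> cd) \<times> (nat \<Rightarrow> cd)"
    where "f x = ((\<lambda>i. if i = 0 then cd_lo 3 x else 0), (\<lambda>i. if i = 0 then oct_conj (cd_hi 3 x) else 0))" for x
  interpret hilbert_left_O_module "cd_module 4" by (simp add: hilbert_left_O_module_cd_module)
  have Suc: "cd_module 4 = cd_module (Suc 3)" by simp
  have "is_linear_O_iso f (cd_module 4) (oct_module ^\<^sub>O 1 \<oplus>\<^sub>O oct_conj_module ^\<^sub>O 1)"
  proof (rule is_linear_O_isoI)
    fix z assume z: "z \<in> ocarrier (oct_module ^\<^sub>O 1 \<oplus>\<^sub>O oct_conj_module ^\<^sub>O 1)"
    obtain u v where uv: "z = (u, v)" by (cases z)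
    let ?x = "cd_join 3 (u 0) (oct_conj (v 0))"
    have "?x \<in> ocarrier (cd_module 4)"
      using cd_join_in_carrier[of 3] by (simp add: cd_module_def)
    moreover have "f ?x = z"
      using z by (auto simp: f_def uv oct_sum_defs cd_lo_join cd_hi_join cd_conj_in_carrier cd_conj_conj fun_eq_iff)
    ultimately show "\<exists>x\<in>ocarrier (cd_module 4). f x = z" by blast
  next
    fix p x assume p: "p \<in> octonions"
    have "oact (cd_module 4) p x = cd_join 3 (oct_mult p (cd_lo 3 x)) (oct_mult (cd_hi 3 x) p)"
      using cd_mult_octonion[OF order_refl p, of x] by (simp add: cd_module_def)
    then show "f (oact (cd_module 4) p x) = oact (oct_module ^\<^sub>O 1 \<oplus>\<^sub>O oct_conj_module ^\<^sub>O 1) p (f x)"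
      by (simp add: f_def oct_sum_defs cd_lo_join cd_hi_join cd_conj_mult cong: if_cong)
  next
    fix x y
    show "oinner (oct_module ^\<^sub>O 1 \<oplus>\<^sub>O oct_conj_module ^\<^sub>O 1) (f x) (f y) = oinner (cd_module 4) x y"
      unfolding Suc by (subst cd_module_Suc_inner)
        (simp_all add: f_def oct_sum_defs cd_module_def oct_proj_octonion)
  next
    fix x y
    show "f (x + y) = f x + f y"
      by (simp add: f_def cd_parts_add(1,2) cd_conj_add cong: if_cong) (simp add: fun_eq_iff)
  next
    fix r x
    show "f (r *\<^sub>R x) = r *\<^sub>R f x"
      by (simp add: f_def cd_parts_scaleR(1,2) cd_conj_scaleR cong: if_cong) (auto simp: scaleR_fun_def fun_eq_iff)
  qed (auto simp: f_def oct_sum_defs subspace_carrier inner_eq_0_iff cd_conj_in_carrier subspace_0)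
  then show ?thesis by blast
qed

section \<open>Concatenation of tuples\<close>

definition append_at :: "nat \<Rightarrow> (nat \<Rightarrow> 'a) \<Rightarrow> (nat \<Rightarrow> 'a) \<Rightarrow> nat \<Rightarrow> 'a" where
  "append_at k u v = (\<lambda>i. if i < k then u i else v (i - k))"

lemma append_at_add: "append_at k (u + u') (v + v') = append_at k u v + append_at k u' v'"
  by (auto simp: append_at_def fun_eq_iff)

lemma append_at_scaleR: "append_at k (r *\<^sub>R u) (r *\<^sub>R v) = r *\<^sub>R append_at k u v"
  by (auto simp: append_at_def fun_eq_iff scaleR_fun_def)

lemma append_at_in_power:
  "u \<in> ocarrier (M ^\<^sub>O k) \<Longrightarrow> v \<in> ocarrier (M ^\<^sub>O l) \<Longrightarrow> append_at k u v \<in> ocarrier (M ^\<^sub>O (k + l))"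
  by (auto simp: omod_power_def append_at_def)

lemma append_at_surj:
  assumes "w \<in> ocarrier (M ^\<^sub>O (k + l))"
  obtains u v where "u \<in> ocarrier (M ^\<^sub>O k)" "v \<in> ocarrier (M ^\<^sub>O l)" "w = append_at k u v"
proof
  \<comment> \<open>The shifted part needs no truncation: \<open>w\<close> vanishes from
    \<open>k + l\<close> on, hence its shift from \<open>l\<close> on.\<close>
  show "(\<lambda>i. if i < k then w i else 0) \<in> ocarrier (M ^\<^sub>O k)" "(\<lambda>i. w (k + i)) \<in> ocarrier (M ^\<^sub>O l)"
    using assms by (auto simp: omod_power_def)
  show "w = append_at k (\<lambda>i. if i < k then w i else 0) (\<lambda>i. w (k + i))"
    by (auto simp: append_at_def)
qed

lemma oact_append_at:
  "oact (M ^\<^sub>O (k + l)) p (append_at k u v) = append_at k (oact (M ^\<^sub>O k) p u) (oact (M ^\<^sub>O l) p v)"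
  by (auto simp: omod_power_def append_at_def fun_eq_iff)

lemma oinner_append_at:
  "oinner (M ^\<^sub>O (k + l)) (append_at k u v) (append_at k u' v')
    = oinner (M ^\<^sub>O k) u u' + oinner (M ^\<^sub>O l) v v'"
  by (simp add: omod_power_def append_at_def sum_lessThan_add)


text \<open>In the doubling step the lower half contributes \<open>K\<close> summands of each kind,
  and the conjugated upper half \<open>K\<close> more of each, with the kinds exchanged by the
  twist.\<close>

lemma cd_module_linear_O_iso:
  assumes "4 \<le> n"
  shows "\<exists>f. is_linear_O_iso f (cd_module n)
    (oct_module ^\<^sub>O 2 ^ (n - 4) \<oplus>\<^sub>O oct_conj_module ^\<^sub>O 2 ^ (n - 4))"
  using assms
proof (induction n rule: dec_induct)
  case base
  then show ?case using cd_module_linear_O_iso_4 by simp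
next
  case (step n)
  define K :: nat where "K = 2 ^ (n - 4)"
  have K: "2 ^ (Suc n - 4) = K + K" unfolding K_def Suc_diff_le[OF step.hyps(1)] by simp
  let ?U = "oct_module ^\<^sub>O K" and ?V = "oct_conj_module ^\<^sub>O K"
  let ?N = "oct_module ^\<^sub>O (K + K) \<oplus>\<^sub>O oct_conj_module ^\<^sub>O (K + K)"
  have n: "3 \<le> n" using step.hyps by simp
  from step.IH obtain f where f: "is_linear_O_iso f (cd_module n) (?U \<oplus>\<^sub>O ?V)"
    by (auto simp: K_def)
  have in_M: "x \<in> ocarrier (cd_module m) \<longleftrightarrow> x \<in> cd_carrier m" for x m
    by (simp add: cd_module_def)
  define u v where "u x = fst (f x)" and "v x = snd (f x)" for x
  have f_eq: "f x = (u x, v x)" for x by (simp add: u_def v_def)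
  have bij: "bij_betw f (cd_carrier n) (ocarrier ?U \<times> ocarrier ?V)"
    using f by (simp add: is_linear_O_iso_def is_hilbert_O_iso_def cd_module_def omod_sum_def)
  have uv_closed: "u x \<in> ocarrier ?U" "v x \<in> ocarrier ?V" if "x \<in> cd_carrier n" for x
    using bij_betw_apply[OF bij that] by (simp_all add: f_eq)
  have uv_add: "u (x + y) = u x + u y" "v (x + y) = v x + v y"
    if "x \<in> cd_carrier n" "y \<in> cd_carrier n" for x y
    using f that by (simp_all add: is_linear_O_iso_def in_M u_def v_def)
  have uv_scaleR: "u (r *\<^sub>R x) = r *\<^sub>R u x" "v (r *\<^sub>R x) = r *\<^sub>R v x"
    if "x \<in> cd_carrier n" for r x
    using f that by (simp_all add: is_linear_O_iso_def in_M u_def v_def)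
  have uv_act: "u (cd_mult n p x) = oact ?U p (u x)" "v (cd_mult n p x) = oact ?V p (v x)"
    if "p \<in> octonions" "x \<in> cd_carrier n" for p x
  proof -
    have "f (oact (cd_module n) p x) = oact (?U \<oplus>\<^sub>O ?V) p (f x)"
      using f that by (simp add: is_linear_O_iso_def is_hilbert_O_iso_def in_M)
    then show "u (cd_mult n p x) = oact ?U p (u x)" "v (cd_mult n p x) = oact ?V p (v x)"
      by (simp_all add: f_eq omod_sum_def cd_module_def)
  qed
  have uv_inner: "oinner (cd_module n) x y = oinner ?U (u x) (u y) + oinner ?V (v x) (v y)"
    if "x \<in> cd_carrier n" "y \<in> cd_carrier n" for x y
  proof -
    have "oinner (?U \<oplus>\<^sub>O ?V) (f x) (f y) = oinner (cd_module n) x y"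
      using f that by (simp add: is_linear_O_iso_def is_hilbert_O_iso_def in_M)
    then show ?thesis by (simp add: f_eq omod_sum_def)
  qed
  \<comment> \<open>\<open>?U\<close> and \<open>?V\<close> are twists of each other: they share the
    carrier, and the actions and inner products pass into one another under conjugation of the
    scalar and exchange of the arguments.\<close>
  have twist_act: "oact ?U (oct_conj p) w = oact ?V p w" "oact ?V (oct_conj p) w = oact ?U p w"
    if "p \<in> octonions" for p w
    using that by (simp_all add: omod_power_def oct_module_def oct_conj_module_def cd_conj_conj cong: if_cong)
  have twist_inner: "oinner ?V w z = oinner ?U z w" for w z
    by (simp add: omod_power_def oct_module_def oct_conj_module_def)
  have twist_carrier: "ocarrier ?V = ocarrier ?U"
    by (simp add: omod_power_def oct_module_def oct_conj_module_def)
  \<comment> \<open>The components of \<open>b\<close> are crossed: \<open>v b\<close> joins the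
    first summand and \<open>u b\<close> the second.\<close>
  define g where "g x = (let a = cd_lo n x; b = cd_conj n (cd_hi n x)
    in (append_at K (u a) (v b), append_at K (v a) (u b)))" for x
  interpret hilbert_left_O_module "cd_module (Suc n)"
    using n by (simp add: hilbert_left_O_module_cd_module)
  have "is_linear_O_iso g (cd_module (Suc n)) ?N"
  proof (rule is_linear_O_isoI)
    fix z assume "z \<in> ocarrier ?N"
    then obtain w w' where z: "z = (w, w')" "w \<in> ocarrier (oct_module ^\<^sub>O (K + K))"
      "w' \<in> ocarrier (oct_conj_module ^\<^sub>O (K + K))"
      by (cases z) (auto simp: omod_sum_def)
    from z(2) obtain w1 w2 where w: "w1 \<in> ocarrier ?U" "w2 \<in> ocarrier ?U" "w = append_at K w1 w2"
      by (rule append_at_surj)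
    from z(3) obtain w1' w2' where w': "w1' \<in> ocarrier ?V" "w2' \<in> ocarrier ?V" "w' = append_at K w1' w2'"
      by (rule append_at_surj)
    obtain a where a: "a \<in> cd_carrier n" "f a = (w1, w1')"
      using bij w w' by (metis (no_types, lifting) SigmaI bij_betw_iff_bijections)
    \<comment> \<open>The crossing in \<open>g\<close> is undone here: \<open>w2'\<close> is read in
      \<open>?U\<close> and \<open>w2\<close> in \<open>?V\<close>, which have the same
      carrier.\<close>
    obtain b where b: "b \<in> cd_carrier n" "f b = (w2', w2)"
      using bij w w' twist_carrier by (metis (no_types, lifting) SigmaI bij_betw_iff_bijections)
    have "g (cd_join n a (cd_conj n b)) = z"
      using a b by (simp add: g_def Let_def f_eq z w w' cd_lo_join cd_hi_join cd_conj_in_carrier cd_conj_conj)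
    then show "\<exists>x\<in>ocarrier (cd_module (Suc n)). g x = z"
      using cd_join_in_carrier in_M by blast
  next
    fix x
    show "g x \<in> ocarrier ?N"
      using uv_closed twist_carrier
      by (simp add: g_def Let_def omod_sum_def cd_conj_in_carrier append_at_in_power)
  next
    fix p x assume p: "p \<in> octonions"
    have "oact (cd_module (Suc n)) p x
        = cd_join n (cd_mult n p (cd_lo n x)) (cd_mult n (cd_hi n x) p)"
      using cd_mult_octonion[OF n p] by (simp add: cd_module_def)
    moreover have "oct_conj p \<in> octonions" using p by (rule cd_conj_in_carrier)
    ultimately show "g (oact (cd_module (Suc n)) p x) = oact ?N p (g x)"
      using p n
      by (simp add: g_def Let_def omod_sum_def cd_lo_join cd_hi_join cd_conj_mult_octonion uv_act
          twist_act cd_conj_in_carrier oact_append_at)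
  next
    fix x y
    show "oinner ?N (g x) (g y) = oinner (cd_module (Suc n)) x y"
      using n by (simp add: cd_module_Suc_inner g_def Let_def omod_sum_def oinner_append_at
          uv_inner cd_conj_in_carrier twist_inner)
  qed (auto simp: g_def Let_def subspace_carrier inner_eq_0_iff subspace_0 cd_parts_add(1,2)
      cd_parts_scaleR(1,2) cd_conj_add cd_conj_scaleR cd_conj_in_carrier uv_add uv_scaleR
      append_at_add append_at_scaleR)
  then show ?case unfolding K by blast
qed

theorem mainTheorem6:
  fixes n :: nat
  assumes "n \<ge> 4"
  shows "hilbert_left_O_module (cd_module n) \<and>
    hilbert_left_O_module (oct_module ^\<^sub>O 2 ^ (n - 4) \<oplus>\<^sub>O oct_conj_module ^\<^sub>O 2 ^ (n - 4)) \<and>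
    (\<exists>f. is_hilbert_O_iso f (cd_module n)
           (oct_module ^\<^sub>O 2 ^ (n - 4) \<oplus>\<^sub>O oct_conj_module ^\<^sub>O 2 ^ (n - 4)))"
proof -
  let ?N = "oct_module ^\<^sub>O 2 ^ (n - 4) \<oplus>\<^sub>O oct_conj_module ^\<^sub>O 2 ^ (n - 4)"
  have M: "hilbert_left_O_module (cd_module n)"
    using assms by (simp add: hilbert_left_O_module_cd_module)
  obtain f where f: "is_linear_O_iso f (cd_module n) ?N"
    using cd_module_linear_O_iso[OF assms] by blast
  have "hilbert_left_O_module ?N"
    using Metric_space_cd_module[of n]
    by (intro hilbert_left_O_module_iso[OF M f] oct_sum_even oct_sum_nonneg) (simp add: cd_module_def)
  with M f show ?thesis by (auto simp: is_linear_O_iso_def)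
qed

end
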